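(* Let $\boldsymbol\lambda=(\lambda_1,\lambda_2,\lambda_3)\in\mathbb C^3$ and define $\boldsymbol\alpha=(\alpha_1,\alpha_2,\alpha_3)$ by $$\alpha_1=-\lambda_1+\lambda_2+\lambda_3,\qquad \alpha_2=-\lambda_2+\lambda_3+\lambda_1,\qquad \alpha_3=-\lambda_3+\lambda_1+\lambda_2 .$$ Then for all $f_1,f_2,f_3\in\mathcal C^\infty(S)$ and all $g\in G$, $$\mathcal K_{\boldsymbol\alpha}(\pi_{\lambda_1}(g)f_1,\pi_{\lambda_2}(g)f_2,\pi_{\lambda_3}(g)f_3)=\mathcal K_{\boldsymbol\alpha}(f_1,f_2,f_3),$$ whenever the integral defining the right-hand side is defined.
   Context: Let $n\ge 3$, $S=\{x\in\mathbb R^n:|x|=1\}$ the unit sphere, $\rho=\frac{n-1}{2}$, and $d\sigma$ the Lebesgue (rotation-invariant Euclidean surface) measure on $S$. Let $q(x)=x_0^2-(x_1^2+\dots+x_n^2)$ on $\mathbb R^{1,n}=\mathbb R^{n+1}$, and let $G=SO_0(1,n)$ be the identity component of the group $SO(1,n)$ of $q$. For $x=(x_1,\dots,x_n)\in S$ put $\widetilde x=(1,x_1,\dots,x_n)$. For $g\in G$, $x\in S$ put $\kappa(g,x)=\big((g\widetilde x)_0\big)^{-1}$, and let $g(x)\in S$ be the unique point with $\widetilde{g(x)}=\kappa(g,x)\,g\widetilde x$; this defines an action of $G$ on $S$. For $\lambda\in\mathbb C$ the representation $\pi_\lambda$ of $G$ on $\mathcal C^\infty(S)$ is $\pi_\lambda(g)f(x)=\kappa(g^{-1},x)^{\rho+\lambda}f(g^{-1}(x))$.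 For $\boldsymbol\alpha\in\mathbb C^3$ let $$K_{\boldsymbol\alpha}(x_1,x_2,x_3)=|x_2-x_3|^{-\rho+\alpha_1}\,|x_3-x_1|^{-\rho+\alpha_2}\,|x_1-x_2|^{-\rho+\alpha_3},$$ $$\mathcal K_{\boldsymbol\alpha}(f_1,f_2,f_3)=\int_{S\times S\times S}K_{\boldsymbol\alpha}(x_1,x_2,x_3)f_1(x_1)f_2(x_2)f_3(x_3)\,d\sigma(x_1)d\sigma(x_2)d\sigma(x_3),$$ where the integral is a Lebesgue integral, defined when it converges absolutely. *)

theory Defs
  imports "HOL-Analysis.Analysis"
begin

abbreviation unit_sphere :: "(real ^ 'n) set" where
  "unit_sphere \<equiv> sphere 0 1"

definition rho :: "'n::finite itself \<Rightarrow> real" where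
  "rho _ = (real CARD('n) - 1) / 2"

text \<open>
  The surface measure is given by the polar-coordinate formula: the measure of a Borel set
  \<open>A\<close> of the sphere is \<open>n\<close> times the volume of the cone
  \<open>{t x | 0 < t \<le> 1, x \<in> A}\<close>; see \<open>emeasure_sphere_measure\<close> below.
\<close>

definition sphere_measure :: "(real ^ 'n) measure" where
  "sphere_measure =
     scale_measure (of_nat CARD('n))
       (distr (restrict_space lborel (cball 0 1 - {0}))
              (restrict_space borel unit_sphere)
              (\<lambda>x. x /\<^sub>R norm x))"

lemma sets_sphere_measure:
  "sets (sphere_measure :: (real ^ 'n) measure) = sets (restrict_space borel unit_sphere)"
  by (simp add: sphere_measure_def)

lemma space_sphere_measure:
  "space (sphere_measure :: (real ^ 'n) measure) = unit_sphere"
  by (simp add: sphere_measure_def space_restrict_space space_scale_measure)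

lemma emeasure_sphere_measure:
  fixes A :: "(real ^ 'n) set"
  assumes "A \<in> sets borel" "A \<subseteq> unit_sphere"
  shows "emeasure sphere_measure A =
           of_nat CARD('n) * emeasure lborel {t *\<^sub>R x | t x. 0 < t \<and> t \<le> 1 \<and> x \<in> A}"
proof -
  let ?B = "cball 0 1 - {0 :: real ^ 'n}"
  let ?p = "\<lambda>x :: real ^ 'n. x /\<^sub>R norm x"
  have B: "?B \<in> sets borel" by simp
  have "?p \<in> borel_measurable lborel" by measurable
  then have m: "?p \<in> restrict_space lborel ?B \<rightarrow>\<^sub>M restrict_space borel unit_sphere"
    by (intro measurable_restrict_space3) (auto simp: norm_divide)
  have A: "A \<in> sets (restrict_space borel unit_sphere)"
    using assms by (auto simp: sets_restrict_space_iff)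
  have eq: "?p -` A \<inter> ?B = {t *\<^sub>R x | t x. 0 < t \<and> t \<le> 1 \<and> x \<in> A}"
  proof (intro equalityI subsetI)
    fix y assume "y \<in> ?p -` A \<inter> ?B"
    then have "y = norm y *\<^sub>R ?p y" "0 < norm y" "norm y \<le> 1" "?p y \<in> A" by auto
    then show "y \<in> {t *\<^sub>R x | t x. 0 < t \<and> t \<le> 1 \<and> x \<in> A}" by blast
  next
    fix y assume "y \<in> {t *\<^sub>R x | t x. 0 < t \<and> t \<le> 1 \<and> x \<in> A}"
    then obtain t x where *: "y = t *\<^sub>R x" "0 < t" "t \<le> 1" "x \<in> A" by blast
    moreover from this have "norm x = 1" using assms by auto
    moreover have "x \<noteq> 0" using \<open>norm x = 1\<close> by auto
    ultimately show "y \<in> ?p -` A \<inter> ?B" by simp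
  qed
  have "emeasure (restrict_space lborel ?B) (?p -` A \<inter> ?B) = emeasure lborel (?p -` A \<inter> ?B)"
    using B by (intro emeasure_restrict_space) auto
  then show ?thesis
    unfolding sphere_measure_def
    using m A by (simp add: emeasure_distr space_restrict_space eq)
qed

text \<open>
  Coordinates of \<open>\<real>\<^sup>1\<^sup>,\<^sup>n\<close> are indexed by \<^typ>\<open>'n option\<close>, with \<^term>\<open>None\<close>
  in the role of the index \<open>0\<close>.
\<close>

definition lorentz_form :: "real ^ ('n::finite option) \<Rightarrow> real" where
  "lorentz_form x = (x $ None)\<^sup>2 - (\<Sum>i\<in>UNIV. (x $ Some i)\<^sup>2)"

definition SO_1n :: "(real ^ ('n::finite option) ^ ('n option)) set" where
  "SO_1n = {g. (\<forall>x. lorentz_form (g *v x) = lorentz_form x) \<and> det g = 1}"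

definition SO0_1n :: "(real ^ ('n::finite option) ^ ('n option)) set" where
  "SO0_1n = connected_component_set SO_1n (mat 1)"

definition lift :: "real ^ 'n \<Rightarrow> real ^ ('n::finite option)" where
  "lift x = (\<chi> i. case i of None \<Rightarrow> 1 | Some j \<Rightarrow> x $ j)"

definition kappa :: "real ^ ('n::finite option) ^ ('n option) \<Rightarrow> real ^ 'n \<Rightarrow> real" where
  "kappa g x = inverse ((g *v lift x) $ None)"

definition sphere_act ::
    "real ^ ('n::finite option) ^ ('n option) \<Rightarrow> real ^ 'n \<Rightarrow> real ^ 'n" where
  "sphere_act g x = (THE y. y \<in> unit_sphere \<and> lift y = kappa g x *\<^sub>R (g *v lift x))"

text \<open>For open \<open>U\<close>, \<open>Ck_on k f U\<close> says that \<open>f\<close> is of class \<open>C\<^sup>k\<close> on \<open>U\<close>.\<close>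

primrec Ck_on ::
    "nat \<Rightarrow> ('a::real_normed_vector \<Rightarrow> 'b::real_normed_vector) \<Rightarrow> 'a set \<Rightarrow> bool" where
  "Ck_on 0 f U \<longleftrightarrow> continuous_on U f"
| "Ck_on (Suc k) f U \<longleftrightarrow>
     (\<forall>x\<in>U. f differentiable (at x)) \<and>
     (\<forall>v. Ck_on k (\<lambda>x. frechet_derivative f (at x) v) U)"

text \<open>
  Functions on the sphere are total functions of which only the values on the sphere matter.
  Smoothness is that of functions on a submanifold of \<open>\<real>\<^sup>n\<close>: locally the restriction of a
  smooth function on an open set of the ambient space.
\<close>

definition smooth_on_sphere :: "(real ^ 'n \<Rightarrow> complex) \<Rightarrow> bool" where
  "smooth_on_sphere f \<longleftrightarrow>
     (\<forall>p\<in>unit_sphere. \<exists>U F. open U \<and> p \<in> U \<and> (\<forall>k. Ck_on k F U) \<and>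
        (\<forall>x\<in>U \<inter> unit_sphere. F x = f x))"

definition pi_rep ::
    "complex \<Rightarrow> real ^ ('n::finite option) ^ ('n option) \<Rightarrow>
      (real ^ 'n \<Rightarrow> complex) \<Rightarrow> real ^ 'n \<Rightarrow> complex" where
  "pi_rep l g f x =
     complex_of_real (kappa (matrix_inv g) x) powr (of_real (rho TYPE('n)) + l) *
     f (sphere_act (matrix_inv g) x)"

text \<open>
  Since \<open>0 powr s = 0\<close>, the kernel takes the value \<open>0\<close> where two of the points coincide.
  This is a null set for the triple product of the surface measure.
\<close>

definition kernel ::
    "complex \<Rightarrow> complex \<Rightarrow> complex \<Rightarrow> real ^ 'n \<Rightarrow> real ^ 'n \<Rightarrow> real ^ 'n \<Rightarrow> complex" where
  "kernel \<alpha>1 \<alpha>2 \<alpha>3 x1 x2 x3 =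
     complex_of_real (norm (x2 - x3)) powr (- of_real (rho TYPE('n)) + \<alpha>1) *
     complex_of_real (norm (x3 - x1)) powr (- of_real (rho TYPE('n)) + \<alpha>2) *
     complex_of_real (norm (x1 - x2)) powr (- of_real (rho TYPE('n)) + \<alpha>3)"

definition trilinear_integrand ::
    "complex \<Rightarrow> complex \<Rightarrow> complex \<Rightarrow>
      (real ^ 'n \<Rightarrow> complex) \<Rightarrow> (real ^ 'n \<Rightarrow> complex) \<Rightarrow> (real ^ 'n \<Rightarrow> complex) \<Rightarrow>
      (real ^ 'n) \<times> (real ^ 'n) \<times> (real ^ 'n) \<Rightarrow> complex" where
  "trilinear_integrand \<alpha>1 \<alpha>2 \<alpha>3 f1 f2 f3 =
     (\<lambda>(x1, x2, x3). kernel \<alpha>1 \<alpha>2 \<alpha>3 x1 x2 x3 * f1 x1 * f2 x2 * f3 x3)"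

abbreviation sphere_measure3 :: "((real ^ 'n) \<times> (real ^ 'n) \<times> (real ^ 'n)) measure" where
  "sphere_measure3 \<equiv> sphere_measure \<Otimes>\<^sub>M (sphere_measure \<Otimes>\<^sub>M sphere_measure)"

definition trilinear_defined ::
    "complex \<Rightarrow> complex \<Rightarrow> complex \<Rightarrow>
      (real ^ 'n \<Rightarrow> complex) \<Rightarrow> (real ^ 'n \<Rightarrow> complex) \<Rightarrow> (real ^ 'n \<Rightarrow> complex) \<Rightarrow> bool" where
  "trilinear_defined \<alpha>1 \<alpha>2 \<alpha>3 f1 f2 f3 \<longleftrightarrow>
     integrable sphere_measure3 (trilinear_integrand \<alpha>1 \<alpha>2 \<alpha>3 f1 f2 f3)"

definition trilinear_form ::
    "complex \<Rightarrow> complex \<Rightarrow> complex \<Rightarrow>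
      (real ^ 'n \<Rightarrow> complex) \<Rightarrow> (real ^ 'n \<Rightarrow> complex) \<Rightarrow> (real ^ 'n \<Rightarrow> complex) \<Rightarrow> complex" where
  "trilinear_form \<alpha>1 \<alpha>2 \<alpha>3 f1 f2 f3 =
     integral\<^sup>L sphere_measure3 (trilinear_integrand \<alpha>1 \<alpha>2 \<alpha>3 f1 f2 f3)"

end

theory Submission
  imports Defs
begin

text \<open>
  Put \<open>h = g\<inverse>\<close> and write \<open>\<kappa>\<close> for the conformal factor \<open>\<kappa>(h, \<cdot>)\<close>. Two facts about the action of
  \<open>h\<close> on the sphere make the trilinear form invariant.

  The first is that \<open>h\<close> multiplies chords by a symmetric factor,
  \<open>|h x - h y|\<^sup>2 = \<kappa>(x) \<kappa>(y) |x - y|\<^sup>2\<close> (\<open>norm_sphere_act_diff\<close>). Indeed, for unit vectors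
  \<open>|x - y|\<^sup>2\<close> is twice the Lorentz product of the null vectors \<open>(1, x)\<close> and \<open>(1, y)\<close>, and \<open>h\<close>
  preserves this product. In the kernel at \<open>(h x\<^sub>1, h x\<^sub>2, h x\<^sub>3)\<close> the point \<open>x\<^sub>1\<close> occurs in the second and
  the third chord and so contributes \<open>\<kappa>(x\<^sub>1)\<close> to the power
  \<open>(- \<rho> + \<alpha>2) / 2 + (- \<rho> + \<alpha>3) / 2 = - \<rho> + l1\<close>. The representation contributes \<open>\<kappa>(x\<^sub>1)\<close> to the power
  \<open>\<rho> + l1\<close>, which is larger by \<open>2 \<rho> = n - 1\<close>; the other two points behave in the same way. Hence the
  transformed integrand is the original one at \<open>(h x\<^sub>1, h x\<^sub>2, h x\<^sub>3)\<close>, multiplied by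
  \<open>(\<kappa>(x\<^sub>1) \<kappa>(x\<^sub>2) \<kappa>(x\<^sub>3))\<^sup>n\<^sup>-\<^sup>1\<close> (\<open>trilinear_integrand_pi_rep\<close>).

  The second is that \<open>\<kappa>\<^sup>n\<^sup>-\<^sup>1\<close> is the Jacobian of \<open>h\<close> for the surface measure
  (\<open>distr_density_sphere_act\<close>). As this measure is defined by volumes of cones, the action is extended
  to \<open>\<Theta>(y) = |y| h(y / |y|)\<close> on the punctured space; \<open>\<Theta>\<close> maps the truncated cone over \<open>A\<close> to the one
  over \<open>h(A)\<close>. Its derivative keeps radial lengths and multiplies lengths orthogonal to the
  radius by \<open>\<kappa>\<close>. This again follows from the invariance of the Lorentz product, because
  \<open>y \<mapsto> (|y|, y)\<close> parametrizes the forward light cone, on which \<open>h\<close> is linear. So the determinant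
  is \<open>\<kappa>\<^sup>n\<^sup>-\<^sup>1\<close> in absolute value (\<open>abs_det_stretch\<close>), and the theorem is the substitution \<open>x\<^sub>i \<mapsto> h x\<^sub>i\<close> in the
  triple integral. The same substitution transports absolute convergence.
\<close>

section \<open>The determinant of a stretch orthogonal to a line\<close>

text \<open>
  The map that fixes \<open>e\<close> and multiplies its orthogonal complement by \<open>c\<close> has the same length
  function as \<open>f\<close>. So \<open>f\<close> is this map up to an isometry, and the determinant of that map is read off in an
  orthonormal basis that contains \<open>e\<close>.
\<close>

lemma abs_det_stretch:
  fixes f :: "real^'n \<Rightarrow> real^'n" and e :: "real^'n"
  assumes f: "linear f" and e: "norm e = 1" and c: "0 < c"
    and stretch: "\<And>u. (norm (f u))\<^sup>2 = c\<^sup>2 * (norm u)\<^sup>2 + (1 - c\<^sup>2) * (e \<bullet> u)\<^sup>2"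
  shows "\<bar>det (matrix f)\<bar> = c ^ (CARD('n) - 1)"
proof -
  fix k :: 'n
  obtain R :: "real^'n \<Rightarrow> real^'n" where R: "orthogonal_transformation R" "R (axis k 1) = e"
    by (rule orthogonal_transformation_exists_1[of "axis k 1" e, OF norm_axis_1 e]) blast
  \<comment> \<open>The inverse of the stretch, in coordinates in which \<open>e\<close> is the basis vector with index \<open>k\<close>.\<close>
  define D :: "real^'n \<Rightarrow> real^'n" where "D u = (\<chi> i. if i = k then u $ i else u $ i / c)" for u
  have D: "linear D"
    by (rule linearI) (auto simp: D_def vec_eq_iff add_divide_distrib)
  have R_lin: "linear R" using R(1) by (rule orthogonal_transformation_linear)
  have norm_D: "(norm (D u))\<^sup>2 = (norm u)\<^sup>2 / c\<^sup>2 + (1 - 1 / c\<^sup>2) * (u $ k)\<^sup>2" for u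
  proof -
    have "(norm (D u))\<^sup>2 = (\<Sum>i\<in>UNIV. (u $ i)\<^sup>2 / c\<^sup>2 + (if i = k then (1 - 1 / c\<^sup>2) * (u $ k)\<^sup>2 else 0))"
      unfolding power2_norm_eq_inner inner_vec_def
      by (auto simp: D_def power2_eq_square algebra_simps intro!: sum.cong)
    also have "\<dots> = (norm u)\<^sup>2 / c\<^sup>2 + (1 - 1 / c\<^sup>2) * (u $ k)\<^sup>2"
      unfolding power2_norm_eq_inner inner_vec_def
      by (simp add: sum.distrib power2_eq_square flip: sum_divide_distrib)
    finally show ?thesis .
  qed
  have "orthogonal_transformation (f \<circ> (R \<circ> D))"
    unfolding orthogonal_transformation
  proof (intro conjI allI)
    show "linear (f \<circ> (R \<circ> D))"
      using f R_lin D by (intro linear_compose)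
    fix u
    have "e \<bullet> R (D u) = R (axis k 1) \<bullet> R (D u)" by (simp add: R)
    also have "\<dots> = axis k 1 \<bullet> D u"
      using R(1) by (simp only: orthogonal_transformation_def)
    also have "\<dots> = u $ k"
      by (simp add: inner_axis' D_def)
    finally have "(norm (f (R (D u))))\<^sup>2 = c\<^sup>2 * (norm (D u))\<^sup>2 + (1 - c\<^sup>2) * (u $ k)\<^sup>2"
      using R(1) by (simp add: stretch orthogonal_transformation)
    also have "\<dots> = (norm u)\<^sup>2"
      using c by (simp add: norm_D field_simps)
    finally show "norm ((f \<circ> (R \<circ> D)) u) = norm u"
      by simp
  qed
  then have "\<bar>det (matrix (f \<circ> (R \<circ> D)))\<bar> = 1" by simp
  moreover have "\<bar>det (matrix R)\<bar> = 1" using R(1) by simp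
  ultimately have 1: "\<bar>det (matrix f)\<bar> * \<bar>det (matrix D)\<bar> = 1"
    using f R_lin D by (simp add: matrix_compose linear_compose det_mul abs_mult)
  have "det (matrix D) = (\<Prod>i\<in>UNIV. if i = k then 1 else 1 / c)"
    by (subst det_diagonal) (auto simp: matrix_def D_def axis_def intro!: prod.cong)
  also have "\<dots> = (1 / c) ^ (CARD('n) - 1)"
    by (subst prod.remove[of _ k]) (auto simp: card_Diff_singleton)
  finally have "\<bar>det (matrix D)\<bar> = inverse (c ^ (CARD('n) - 1))"
    using c by (simp add: inverse_eq_divide power_one_over)
  with 1 have "\<bar>det (matrix f)\<bar> * inverse (c ^ (CARD('n) - 1)) = 1"
    by (simp only:)
  then show ?thesis
    using c by (simp add: field_simps)
qed

section \<open>Change of variables for maps with one undistorted direction\<close>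

text \<open>
  The change of variables theorem for differentiable maps assumes a well-order on the finite
  type that indexes the coordinates. An arbitrary finite index type is
  replaced by a well-ordered copy; the relabelling of coordinates is an isometry that
  preserves Lebesgue measure, and a hypothesis on the lengths \<open>norm (f' x u)\<close>, unlike one on
  determinants, is visibly unchanged by it.
\<close>

typedef ('n::finite) ordered_index = "{..<CARD('n)}"
  by (rule exI[of _ 0]) auto

instantiation ordered_index :: (finite) "{finite, wellorder}"
begin

definition less_eq_ordered_index :: "'a ordered_index \<Rightarrow> 'a ordered_index \<Rightarrow> bool" where
  "i \<le> j \<longleftrightarrow> Rep_ordered_index i \<le> Rep_ordered_index j"

definition less_ordered_index :: "'a ordered_index \<Rightarrow> 'a ordered_index \<Rightarrow> bool" where
  "i < j \<longleftrightarrow> Rep_ordered_index i < Rep_ordered_index j"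

instance
proof
  have "finite (Abs_ordered_index ` {..<CARD('a)} :: 'a ordered_index set)" by simp
  then show "finite (UNIV :: 'a ordered_index set)"
    by (simp add: type_definition.Abs_image[OF type_definition_ordered_index])
  fix P and i :: "'a ordered_index"
  assume step: "\<And>i :: 'a ordered_index. (\<And>j. j < i \<Longrightarrow> P j) \<Longrightarrow> P i"
  show "P i"
    by (induction i rule: measure_induct_rule[of Rep_ordered_index])
      (auto intro: step simp: less_ordered_index_def)
qed (auto simp: less_eq_ordered_index_def less_ordered_index_def Rep_ordered_index_inject)

end

lemma CARD_ordered_index: "CARD('n::finite ordered_index) = CARD('n)"
  using type_definition.card[OF type_definition_ordered_index[where 'n='n]] by simp

definition index_bij :: "'n::finite ordered_index \<Rightarrow> 'n" where
  "index_bij = (SOME b. bij b)"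

lemma bij_index_bij: "bij (index_bij :: 'n::finite ordered_index \<Rightarrow> 'n)"
proof -
  have "\<exists>b :: 'n ordered_index \<Rightarrow> 'n. bij b"
    by (rule finite_same_card_bij) (simp_all add: CARD_ordered_index)
  then show ?thesis
    unfolding index_bij_def by (rule someI_ex)
qed

definition reindex :: "real^'n::finite \<Rightarrow> real^'n ordered_index" where
  "reindex x = (\<chi> i. x $ index_bij i)"

definition unindex :: "real^'n::finite ordered_index \<Rightarrow> real^'n" where
  "unindex y = (\<chi> j. y $ inv index_bij j)"

lemma unindex_reindex [simp]: "unindex (reindex x) = x"
  by (simp add: unindex_def reindex_def bij_index_bij bij_is_surj surj_f_inv_f)

lemma reindex_unindex [simp]: "reindex (unindex x) = x"
  by (simp add: unindex_def reindex_def bij_index_bij bij_is_inj inv_f_f)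

lemma linear_reindex: "linear reindex"
  by (rule linearI) (auto simp: reindex_def vec_eq_iff)

lemma linear_unindex: "linear unindex"
  by (rule linearI) (auto simp: unindex_def vec_eq_iff)

lemma bounded_linear_reindex: "bounded_linear reindex"
  by (simp add: linear_conv_bounded_linear[symmetric] linear_reindex)

lemma bounded_linear_unindex: "bounded_linear unindex"
  by (simp add: linear_conv_bounded_linear[symmetric] linear_unindex)

lemma inner_reindex [simp]: "reindex x \<bullet> reindex y = x \<bullet> y"
  unfolding reindex_def inner_vec_def
  by (simp add: sum.reindex_bij_betw[OF bij_index_bij, of "\<lambda>j. x $ j * y $ j"])

lemma norm_reindex [simp]: "norm (reindex x) = norm x"
  by (simp add: norm_eq_sqrt_inner)

lemma norm_unindex [simp]: "norm (unindex y) = norm y"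
  using norm_reindex[of "unindex y"] by simp

lemma measurable_reindex [measurable]: "reindex \<in> borel_measurable borel"
  by (intro borel_measurable_continuous_onI linear_continuous_on bounded_linear_reindex)

lemma measurable_unindex [measurable]: "unindex \<in> borel_measurable borel"
  by (intro borel_measurable_continuous_onI linear_continuous_on bounded_linear_unindex)

lemma Basis_real_vec: "(Basis :: (real^'n) set) = range (\<lambda>j. axis j 1)"
  by (auto simp: Basis_vec_def)

lemma reindex_image_Basis: "reindex ` (Basis :: (real^'n::finite) set) = Basis"
proof -
  have axis: "reindex (axis j 1 :: real^'n) = axis (inv index_bij j) 1" for j
    by (auto simp: reindex_def axis_def vec_eq_iff bij_index_bij bij_is_surj surj_f_inv_f
        bij_is_inj inv_f_f)
  have inv: "surj (inv index_bij :: 'n \<Rightarrow> 'n ordered_index)"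
    by (simp add: bij_imp_bij_inv bij_index_bij bij_is_surj)
  have "reindex ` (Basis :: (real^'n) set) = (\<lambda>i. axis i 1) ` range (inv index_bij)"
    by (simp add: Basis_real_vec image_image axis)
  also have "\<dots> = (Basis :: (real^'n ordered_index) set)"
    unfolding Basis_real_vec inv ..
  finally show ?thesis .
qed

lemma distr_lborel_reindex: "distr lborel borel reindex = lborel"
proof (rule lborel_eqI[symmetric])
  fix l u :: "real^'a ordered_index"
  assume le: "\<And>b. b \<in> Basis \<Longrightarrow> l \<bullet> b \<le> u \<bullet> b"
  have adjoint: "unindex v \<bullet> b = v \<bullet> reindex b" for v and b :: "real^'a"
    using inner_reindex[of "unindex v" b] by simp
  have "reindex -` box l u = box (unindex l) (unindex u)"
    by (auto simp: mem_box reindex_image_Basis[symmetric] adjoint)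
  moreover have "unindex l \<bullet> b \<le> unindex u \<bullet> b" if "b \<in> Basis" for b
    unfolding adjoint using that reindex_image_Basis by (intro le) blast
  ultimately have "emeasure (distr lborel borel reindex) (box l u)
      = (\<Prod>b\<in>Basis. (unindex u - unindex l) \<bullet> b)"
    by (simp add: emeasure_distr)
  also have "\<dots> = (\<Prod>b\<in>reindex ` Basis. (u - l) \<bullet> b)"
    by (subst prod.reindex) (auto simp: inner_diff_left adjoint intro!: inj_onI dest: arg_cong[of _ _ unindex])
  finally show "emeasure (distr lborel borel reindex) (box l u) = (\<Prod>b\<in>Basis. (u - l) \<bullet> b)"
    by (simp add: reindex_image_Basis)
qed simp

lemma emeasure_stretch_image_wellorder:
  fixes f :: "real^'m::{finite,wellorder} \<Rightarrow> real^'m::_" and c :: "real^'m::_ \<Rightarrow> real"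
  assumes S: "S \<in> sets borel" and fS: "f ` S \<in> sets borel" "bounded (f ` S)"
    and der: "\<And>x. x \<in> S \<Longrightarrow> (f has_derivative f' x) (at x)" and inj: "inj_on f S"
    and e: "\<And>x. x \<in> S \<Longrightarrow> norm (e x) = 1" and c: "\<And>x. x \<in> S \<Longrightarrow> 0 < c x"
    and stretch: "\<And>x u. x \<in> S \<Longrightarrow>
      (norm (f' x u))\<^sup>2 = (c x)\<^sup>2 * (norm u)\<^sup>2 + (1 - (c x)\<^sup>2) * (e x \<bullet> u)\<^sup>2"
  shows "emeasure lborel (f ` S) = (\<integral>\<^sup>+x. ennreal (c x ^ (CARD('m) - 1)) * indicator S x \<partial>lborel)"
proof -
  have fS': "f ` S \<in> lmeasurable"
    using fS by (simp add: bounded_set_imp_lmeasurable)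
  have det: "\<bar>det (matrix (f' x))\<bar> = c x ^ (CARD('m) - 1)" if "x \<in> S" for x
    using that by (intro abs_det_stretch[OF _ e c stretch] has_derivative_linear[OF der])
  have "((\<lambda>x. \<bar>det (matrix (f' x))\<bar>) has_integral measure lebesgue (f ` S)) S"
    using has_measure_differentiable_image[of S f f'] S der inj fS'
    by (auto intro: has_derivative_at_withinI)
  then have "((\<lambda>x. c x ^ (CARD('m) - 1)) has_integral measure lebesgue (f ` S)) S"
    by (rule has_integral_eq[rotated]) (simp add: det)
  then have "(\<integral>\<^sup>+x. ennreal (c x ^ (CARD('m) - 1)) * indicator S x \<partial>lborel) = measure lebesgue (f ` S)"
    by (intro nn_integral_has_integral_lebesgue') (auto intro: zero_le_power less_imp_le c)
  also have "\<dots> = emeasure lebesgue (f ` S)"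
    using fS' by (simp add: emeasure_eq_measure2)
  finally show ?thesis
    using fS by simp
qed

lemma emeasure_lborel_reindex:
  fixes A :: "(real^'n::finite) set"
  assumes "A \<in> sets borel"
  shows "reindex ` A \<in> sets borel" "emeasure lborel (reindex ` A) = emeasure lborel A"
proof -
  have eq: "reindex ` A = unindex -` A"
    by (auto intro!: image_eqI[where x="unindex _"])
  show *: "reindex ` A \<in> sets borel"
    unfolding eq using measurable_sets[OF measurable_unindex assms] by simp
  have "reindex -` reindex ` A = A"
    by (auto dest: arg_cong[of _ _ unindex])
  with * show "emeasure lborel (reindex ` A) = emeasure lborel A"
    by (subst distr_lborel_reindex[symmetric]) (simp add: emeasure_distr)
qed

lemma emeasure_stretch_image:
  fixes f :: "real^'n::finite \<Rightarrow> real^'n" and c :: "real^'n \<Rightarrow> real"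
  assumes S: "S \<in> sets borel" and fS: "f ` S \<in> sets borel" "bounded (f ` S)"
    and der: "\<And>x. x \<in> S \<Longrightarrow> (f has_derivative f' x) (at x)" and inj: "inj_on f S"
    and e: "\<And>x. x \<in> S \<Longrightarrow> norm (e x) = 1" and c: "\<And>x. x \<in> S \<Longrightarrow> 0 < c x"
    and c_meas: "c \<in> borel_measurable borel"
    and stretch: "\<And>x u. x \<in> S \<Longrightarrow>
      (norm (f' x u))\<^sup>2 = (c x)\<^sup>2 * (norm u)\<^sup>2 + (1 - (c x)\<^sup>2) * (e x \<bullet> u)\<^sup>2"
  shows "emeasure lborel (f ` S) = (\<integral>\<^sup>+x. ennreal (c x ^ (CARD('n) - 1)) * indicator S x \<partial>lborel)"
proof -
  let ?F = "reindex \<circ> f \<circ> unindex" and ?S = "reindex ` S"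
  have image: "?F ` ?S = reindex ` f ` S"
    by (simp add: image_image)
  have inner: "reindex v \<bullet> w = v \<bullet> unindex w" for v :: "real^'n" and w
    using inner_reindex[of v "unindex w"] by simp
  have "emeasure lborel (?F ` ?S) =
      (\<integral>\<^sup>+y. ennreal (c (unindex y) ^ (CARD('n ordered_index) - 1)) * indicator ?S y \<partial>lborel)"
  proof (rule emeasure_stretch_image_wellorder[where f' = "\<lambda>y. reindex \<circ> f' (unindex y) \<circ> unindex"
        and e = "\<lambda>y. reindex (e (unindex y))"])
    show "?S \<in> sets borel" "?F ` ?S \<in> sets borel"
      unfolding image using S fS by (auto intro: emeasure_lborel_reindex)
    show "bounded (?F ` ?S)"
      unfolding image using fS(2) by (simp add: bounded_linear_image bounded_linear_reindex)
    show "inj_on ?F ?S"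
      using inj by (auto simp: inj_on_def dest!: arg_cong[of "reindex _" _ unindex])
    fix y assume "y \<in> ?S"
    then have y: "unindex y \<in> S" by auto
    show "(?F has_derivative reindex \<circ> f' (unindex y) \<circ> unindex) (at y)"
      by (intro diff_chain_at bounded_linear_imp_has_derivative bounded_linear_unindex
          bounded_linear_reindex der y)
    show "norm (reindex (e (unindex y))) = 1" "0 < c (unindex y)"
      using e c y by auto
    show "(norm ((reindex \<circ> f' (unindex y) \<circ> unindex) u))\<^sup>2 = (c (unindex y))\<^sup>2 * (norm u)\<^sup>2
        + (1 - (c (unindex y))\<^sup>2) * (reindex (e (unindex y)) \<bullet> u)\<^sup>2" for u
      using stretch[OF y, of "unindex u"] by (simp add: inner)
  qed
  also have "\<dots> = (\<integral>\<^sup>+y. ennreal (c (unindex y) ^ (CARD('n) - 1)) * indicator S (unindex y)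
      \<partial>distr lborel borel reindex)"
    unfolding distr_lborel_reindex CARD_ordered_index
    by (intro nn_integral_cong arg_cong2[where f="(*)"] refl)
      (auto simp: indicator_def intro!: image_eqI[where x="unindex _"])
  also have "\<dots> = (\<integral>\<^sup>+x. ennreal (c x ^ (CARD('n) - 1)) * indicator S x \<partial>lborel)"
    using S c_meas by (subst nn_integral_distr) auto
  finally show ?thesis
    using fS by (simp only: image emeasure_lborel_reindex)
qed

section \<open>Lorentz geometry of the action on the sphere\<close>

definition spacetime :: "real \<Rightarrow> real^'n \<Rightarrow> real^('n::finite option)" where
  "spacetime t y = (\<chi> i. case i of None \<Rightarrow> t | Some j \<Rightarrow> y $ j)"

definition spatial :: "real^('n::finite option) \<Rightarrow> real^'n" where
  "spatial v = (\<chi> j. v $ Some j)"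

definition lorentz_inner :: "real^('n::finite option) \<Rightarrow> real^('n option) \<Rightarrow> real" where
  "lorentz_inner v w = v $ None * w $ None - spatial v \<bullet> spatial w"

lemma time_spacetime [simp]: "spacetime t y $ None = t"
  by (simp add: spacetime_def)

lemma spatial_spacetime [simp]: "spatial (spacetime t y) = y"
  by (simp add: spacetime_def spatial_def vec_eq_iff)

lemma spacetime_eqI: "v $ None = w $ None \<Longrightarrow> spatial v = spatial w \<Longrightarrow> v = w"
  by (simp add: vec_eq_iff spatial_def split_option_all)

lemma spacetime_eq_iff [simp]: "spacetime s x = spacetime t y \<longleftrightarrow> s = t \<and> x = y"
  by (metis time_spacetime spatial_spacetime)

lemma spatial_scaleR [simp]: "spatial (c *\<^sub>R v) = c *\<^sub>R spatial v"
  by (simp add: spatial_def vec_eq_iff)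

lemma spatial_add [simp]: "spatial (v + w) = spatial v + spatial w"
  by (simp add: spatial_def vec_eq_iff)

lemma scaleR_spacetime: "c *\<^sub>R spacetime t y = spacetime (c * t) (c *\<^sub>R y)"
  by (rule spacetime_eqI) simp_all

lemma lift_eq_spacetime: "lift x = spacetime 1 x"
  by (simp add: lift_def spacetime_def)

lemma lorentz_form_eq_inner: "lorentz_form v = lorentz_inner v v"
  by (simp add: lorentz_form_def lorentz_inner_def spatial_def inner_vec_def power2_eq_square)

lemma lorentz_form_eq: "lorentz_form v = (v $ None)\<^sup>2 - (norm (spatial v))\<^sup>2"
  by (simp add: lorentz_form_eq_inner lorentz_inner_def power2_eq_square dot_square_norm)

lemma lorentz_form_add:
  "lorentz_form (v + w) = lorentz_form v + lorentz_form w + 2 * lorentz_inner v w"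
  by (simp add: lorentz_form_eq_inner lorentz_inner_def inner_add_left inner_add_right
      inner_commute algebra_simps)

lemma bounded_linear_spacetime: "bounded_linear (\<lambda>p. spacetime (fst p) (snd p))"
  unfolding linear_conv_bounded_linear[symmetric]
  by (rule linearI) (auto simp: scaleR_spacetime intro: spacetime_eqI)

lemma bounded_linear_spatial: "bounded_linear spatial"
  unfolding linear_conv_bounded_linear[symmetric] by (rule linearI) auto

text \<open>
  A transformation preserving the form maps the light cone to itself; such a transformation is
  orthochronous when it does not exchange the two halves of the cone. It then acts on the sphere of
  forward null rays with a positive conformal factor.
\<close>

definition orthochronous :: "real^('n::finite option)^('n option) \<Rightarrow> bool" where
  "orthochronous h \<longleftrightarrow> (\<forall>v. lorentz_form (h *v v) = lorentz_form v) \<and>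
     (\<forall>x. norm x = 1 \<longrightarrow> 0 < (h *v lift x) $ None)"

lemma lorentz_inner_preserved:
  assumes "\<forall>v. lorentz_form (h *v v) = lorentz_form v"
  shows "lorentz_inner (h *v v) (h *v w) = lorentz_inner v w"
  using lorentz_form_add[of v w] lorentz_form_add[of "h *v v" "h *v w"] assms
  by (simp add: matrix_vector_right_distrib[symmetric])

lemma lorentz_form_lift: "norm x = 1 \<Longrightarrow> lorentz_form (lift x) = 0"
  by (simp add: lorentz_form_eq lift_eq_spacetime)

text \<open>
  This extension of the action preserves the norm, so that it maps truncated cones to truncated cones.
\<close>

definition radial_act :: "real^('n::finite option)^('n option) \<Rightarrow> real^'n \<Rightarrow> real^'n" where
  "radial_act h y = norm y *\<^sub>R sphere_act h (sgn y)"

context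
  fixes h :: "real^('n::finite option)^('n option)"
  assumes h: "orthochronous h"
begin

lemma kappa_pos: "norm x = 1 \<Longrightarrow> 0 < kappa h x"
  using h by (simp add: orthochronous_def kappa_def)

lemma norm_spatial_orthochronous:
  assumes "norm x = 1"
  shows "norm (spatial (h *v lift x)) = (h *v lift x) $ None"
proof -
  have "lorentz_form (h *v lift x) = 0" "0 < (h *v lift x) $ None"
    using h assms by (simp_all add: orthochronous_def lorentz_form_lift)
  then show ?thesis
    by (simp add: lorentz_form_eq)
qed

lemma sphere_act_eq:
  assumes "norm x = 1"
  shows "sphere_act h x = kappa h x *\<^sub>R spatial (h *v lift x)"
    and "norm (sphere_act h x) = 1"
proof -
  let ?y = "kappa h x *\<^sub>R spatial (h *v lift x)"
  have pos: "0 < (h *v lift x) $ None"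
    using h assms by (simp add: orthochronous_def)
  have y: "norm ?y = 1"
    using pos norm_spatial_orthochronous[OF assms] by (simp add: kappa_def)
  show eq: "sphere_act h x = ?y"
    unfolding sphere_act_def
  proof (rule the_equality)
    show "?y \<in> unit_sphere \<and> lift ?y = kappa h x *\<^sub>R (h *v lift x)"
      using y pos by (auto simp: lift_eq_spacetime kappa_def intro: spacetime_eqI)
    show "y = ?y" if "y \<in> unit_sphere \<and> lift y = kappa h x *\<^sub>R (h *v lift x)" for y
      using that by (metis lift_eq_spacetime spatial_scaleR spatial_spacetime)
  qed
  show "norm (sphere_act h x) = 1"
    using y by (simp add: eq)
qed

lemma lift_sphere_act:
  assumes "norm x = 1"
  shows "lift (sphere_act h x) = kappa h x *\<^sub>R (h *v lift x)"
  using assms kappa_pos[OF assms]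
  by (auto simp: sphere_act_eq lift_eq_spacetime kappa_def intro!: spacetime_eqI)

text \<open>
  The squared chord between unit vectors is twice the Lorentz product of their lifts, and lifting
  the action multiplies the product by the two conformal factors.
\<close>

lemma norm_sphere_act_diff:
  assumes "norm x = 1" "norm y = 1"
  shows "(norm (sphere_act h x - sphere_act h y))\<^sup>2 = kappa h x * kappa h y * (norm (x - y))\<^sup>2"
proof -
  have chord: "(norm (x - y))\<^sup>2 = 2 * lorentz_inner (lift x) (lift y)"
    if "norm x = 1" "norm y = 1" for x y :: "real^'n"
    using that
    by (simp add: lorentz_inner_def lift_eq_spacetime power2_norm_eq_inner inner_diff_left
        inner_diff_right inner_commute norm_eq_1)
  have "(norm (sphere_act h x - sphere_act h y))\<^sup>2
      = 2 * lorentz_inner (kappa h x *\<^sub>R (h *v lift x)) (kappa h y *\<^sub>R (h *v lift y))"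
    using assms by (simp add: chord sphere_act_eq(2) lift_sphere_act)
  also have "\<dots> = kappa h x * kappa h y * (2 * lorentz_inner (h *v lift x) (h *v lift y))"
    by (simp add: lorentz_inner_def algebra_simps)
  also have "\<dots> = kappa h x * kappa h y * (norm (x - y))\<^sup>2"
    using h assms by (simp add: chord lorentz_inner_preserved orthochronous_def)
  finally show ?thesis .
qed

lemma null_cone_map:
  assumes "y \<noteq> 0"
  shows "h *v spacetime (norm y) y = norm y *\<^sub>R (h *v lift (sgn y))"
proof -
  have "spacetime (norm y) y = norm y *\<^sub>R lift (sgn y)"
    using assms by (simp add: lift_eq_spacetime scaleR_spacetime sgn_div_norm)
  then show ?thesis by (simp add: matrix_vector_mult_scaleR)
qed

lemma radial_act_eq:
  assumes "y \<noteq> 0"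
  defines "P \<equiv> spatial (h *v spacetime (norm y) y)"
  shows "norm P = norm y / kappa h (sgn y)" "radial_act h y = (norm y * inverse (norm P)) *\<^sub>R P"
proof -
  have y: "norm (sgn y) = 1" using assms by (simp add: norm_sgn)
  have pos: "0 < kappa h (sgn y)" using y by (rule kappa_pos)
  show P: "norm P = norm y / kappa h (sgn y)"
    using assms y by (simp add: P_def null_cone_map norm_spatial_orthochronous kappa_def divide_inverse)
  show "radial_act h y = (norm y * inverse (norm P)) *\<^sub>R P"
    using assms pos y unfolding P
    by (simp add: P_def null_cone_map radial_act_def sphere_act_eq field_simps)
qed

text \<open>
  Write \<open>P(y)\<close> for the spatial part of \<open>h (|y|, y)\<close>, so that the extended action is \<open>|y| P / |P|\<close>. Let
  \<open>Q\<close> be the derivative of \<open>P\<close> in the direction \<open>u\<close>, let \<open>N = P / |P|\<close>, and let \<open>k = |y| / |P|\<close>, which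
  is the conformal factor. The derivative of the extended action is
  \<open>k Q + (sgn y \<bullet> u - k (N \<bullet> Q)) N\<close>: its component along \<open>N\<close> is \<open>sgn y \<bullet> u\<close>, and its component orthogonal
  to \<open>N\<close> has squared length \<open>k\<^sup>2 (|Q|\<^sup>2 - (N \<bullet> Q)\<^sup>2)\<close>. Now \<open>h (sgn y \<bullet> u, u)\<close> is tangent to the light cone
  and has time component \<open>N \<bullet> Q\<close>, so invariance of the form gives
  \<open>|Q|\<^sup>2 - (N \<bullet> Q)\<^sup>2 = |u|\<^sup>2 - (sgn y \<bullet> u)\<^sup>2\<close>.
\<close>

lemma radial_act_derivative:
  assumes y: "y \<noteq> 0"
  obtains D where "(radial_act h has_derivative D) (at y)"
    and "\<And>u. (norm (D u))\<^sup>2 = (kappa h (sgn y))\<^sup>2 * (norm u)\<^sup>2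
      + (1 - (kappa h (sgn y))\<^sup>2) * (sgn y \<bullet> u)\<^sup>2"
proof -
  define P where "P y = spatial (h *v spacetime (norm y) y)" for y
  define V where "V u = h *v spacetime (sgn y \<bullet> u) u" for u
  define k where "k = kappa h (sgn y)"
  have unit: "norm (sgn y) = 1" using y by (simp add: norm_sgn)
  have k: "0 < k" unfolding k_def using unit by (rule kappa_pos)
  have norm_P: "norm (P y) = norm y / k"
    using radial_act_eq(1)[OF y] by (simp add: P_def k_def)
  have P0: "P y \<noteq> 0" using norm_P y k by auto
  have bl: "bounded_linear (\<lambda>p. spatial (h *v spacetime (fst p) (snd p)))"
    using bounded_linear_compose[OF bounded_linear_spatial
        bounded_linear_compose[OF matrix_vector_mul_bounded_linear bounded_linear_spacetime]] .
  have dP: "(P has_derivative (\<lambda>u. spatial (V u))) (at y)"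
  proof -
    have "((\<lambda>y. (norm y, y)) has_derivative (\<lambda>u. (sgn y \<bullet> u, u))) (at y)"
      using y by (auto intro!: derivative_eq_intros has_derivative_norm simp: inner_commute)
    from bounded_linear.has_derivative[OF bl this] show ?thesis
      by (simp add: P_def[abs_def] V_def)
  qed
  have dnP: "((\<lambda>y. norm (P y)) has_derivative (\<lambda>u. sgn (P y) \<bullet> spatial (V u))) (at y)"
    using has_derivative_compose[OF dP has_derivative_norm[OF P0]] by (simp add: inner_commute)
  define D where "D u = (norm y * inverse (norm (P y))) *\<^sub>R spatial (V u)
    + (norm y * - (inverse (norm (P y)) * (sgn (P y) \<bullet> spatial (V u)) * inverse (norm (P y)))
       + (sgn y \<bullet> u) * inverse (norm (P y))) *\<^sub>R P y" for u
  have dny: "(norm has_derivative (\<lambda>u. sgn y \<bullet> u)) (at y)"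
    using has_derivative_norm[OF y] by (simp add: inner_commute)
  have "((\<lambda>y. (norm y * inverse (norm (P y))) *\<^sub>R P y) has_derivative D) (at y)"
    unfolding D_def[abs_def]
    by (rule has_derivative_scaleR[OF has_derivative_mult[OF dny Deriv.has_derivative_inverse[OF _ dnP]] dP])
      (use P0 in simp)
  then have "(radial_act h has_derivative D) (at y)"
    by (rule has_derivative_transform_within_open[where s="- {0}"])
      (use y in \<open>auto simp: radial_act_eq(2) P_def\<close>)
  moreover have "(norm (D u))\<^sup>2 = k\<^sup>2 * (norm u)\<^sup>2 + (1 - k\<^sup>2) * (sgn y \<bullet> u)\<^sup>2" for u
  proof -
    let ?N = "sgn (P y)" and ?Q = "spatial (V u)"
    have N: "?N \<bullet> ?N = 1" using P0 by (simp add: norm_eq_1[symmetric] norm_sgn)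
    have PN: "P y = norm (P y) *\<^sub>R ?N" using P0 by (simp add: sgn_div_norm)
    \<comment> \<open>A tangent vector of the light cone at a point is Lorentz orthogonal to that point.\<close>
    have "lorentz_inner (h *v spacetime (norm y) y) (V u) = 0"
      unfolding V_def using h y
      by (subst lorentz_inner_preserved)
        (auto simp: orthochronous_def lorentz_inner_def sgn_div_norm)
    moreover have "(h *v spacetime (norm y) y) $ None = norm (P y)"
      using y unit by (simp add: P_def null_cone_map norm_spatial_orthochronous)
    ultimately have "norm (P y) * (V u $ None) = P y \<bullet> ?Q"
      by (simp add: lorentz_inner_def P_def)
    also have "\<dots> = norm (P y) * (?N \<bullet> ?Q)"
      by (subst PN) simp
    finally have time: "V u $ None = ?N \<bullet> ?Q" using P0 by simp
    have "lorentz_form (V u) = lorentz_form (spacetime (sgn y \<bullet> u) u)"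
      using h by (simp add: V_def orthochronous_def)
    then have form: "(norm ?Q)\<^sup>2 = (?N \<bullet> ?Q)\<^sup>2 - (sgn y \<bullet> u)\<^sup>2 + (norm u)\<^sup>2"
      by (simp add: lorentz_form_eq time)
    have yk: "norm y * inverse (norm (P y)) = k"
      using y k by (simp add: norm_P)
    have "D u = k *\<^sub>R ?Q + ((sgn y \<bullet> u) - k * (?N \<bullet> ?Q)) *\<^sub>R ?N"
    proof -
      let ?c = "norm y * - (inverse (norm (P y)) * (?N \<bullet> ?Q) * inverse (norm (P y)))
        + (sgn y \<bullet> u) * inverse (norm (P y))"
      have "?c = ((sgn y \<bullet> u) - (norm y * inverse (norm (P y))) * (?N \<bullet> ?Q)) * inverse (norm (P y))"
        by (simp add: algebra_simps)
      then have "?c * norm (P y) = (sgn y \<bullet> u) - k * (?N \<bullet> ?Q)"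
        unfolding yk using P0 by simp
      moreover have "?c *\<^sub>R P y = (?c * norm (P y)) *\<^sub>R ?N"
        by (metis PN scaleR_scaleR)
      ultimately show ?thesis
        unfolding D_def yk by simp
    qed
    moreover have "(norm (a *\<^sub>R v + b *\<^sub>R w))\<^sup>2 = a\<^sup>2 * (norm v)\<^sup>2 + b\<^sup>2 * (w \<bullet> w) + 2 * a * b * (w \<bullet> v)"
      for a b and v w :: "real^'n"
      unfolding power2_norm_eq_inner
      by (simp add: inner_add_left inner_add_right inner_commute[of v w] power2_eq_square distrib_left)
    ultimately have "(norm (D u))\<^sup>2 = k\<^sup>2 * (norm ?Q)\<^sup>2 + ((sgn y \<bullet> u) - k * (?N \<bullet> ?Q))\<^sup>2 * (?N \<bullet> ?N)
        + 2 * k * ((sgn y \<bullet> u) - k * (?N \<bullet> ?Q)) * (?N \<bullet> ?Q)"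
      by (simp only:)
    then show ?thesis
      unfolding N form by (simp add: power2_eq_square algebra_simps)
  qed
  ultimately show thesis
    using that unfolding k_def by blast
qed

end

text \<open>
  If the inverse sent a forward null vector to a backward one, then \<open>h\<close> would send the negative of the
  latter, which is forward, to a backward vector.
\<close>

lemma orthochronous_inverse:
  assumes h: "orthochronous h" and inv: "h ** h' = mat 1"
  shows "orthochronous h'"
proof -
  have hh': "h *v (h' *v v) = v" for v
    by (simp add: matrix_vector_mul_assoc inv)
  have form: "lorentz_form (h' *v v) = lorentz_form v" for v
    using h hh'[of v] by (metis orthochronous_def)
  moreover have "0 < (h' *v lift x) $ None" if x: "norm x = 1" for x
  proof (rule ccontr)
    define w where "w = h' *v lift x"
    assume "\<not> 0 < (h' *v lift x) $ None"
    then have "w $ None \<le> 0" by (simp add: w_def)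
    have "lorentz_form w = 0" using x by (simp add: w_def form lorentz_form_lift)
    then have "norm (spatial w) = - (w $ None)"
      using \<open>w $ None \<le> 0\<close>
      by (simp add: lorentz_form_eq power2_eq_iff_nonneg) (smt (verit) norm_ge_zero power2_eq_iff)
    moreover have hw: "h *v w = lift x" by (simp add: w_def hh')
    then have "w \<noteq> 0" by (auto simp: lift_eq_spacetime dest: arg_cong[of _ _ "\<lambda>v. v $ None"])
    ultimately have neg: "w $ None < 0"
      using \<open>w $ None \<le> 0\<close>
      by (metis less_eq_real_def norm_zero spacetime_eqI zero_index norm_eq_zero
          neg_equal_0_iff_equal spatial_scaleR scale_zero_left)
    \<comment> \<open>The backward vector \<open>w\<close> is a negative multiple of the lift of the unit vector \<open>z\<close>.\<close>
    define z where "z = (1 / (w $ None)) *\<^sub>R spatial w"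
    have "norm z = 1"
      using \<open>norm (spatial w) = - (w $ None)\<close> neg by (simp add: z_def)
    then have "0 < (h *v lift z) $ None"
      using h by (simp add: orthochronous_def)
    moreover have "lift z = (1 / (w $ None)) *\<^sub>R w"
      using neg by (auto simp: lift_eq_spacetime z_def intro: spacetime_eqI)
    ultimately show False
      using neg by (simp add: matrix_vector_mult_scaleR hw lift_eq_spacetime zero_less_divide_iff)
  qed
  ultimately show ?thesis by (simp add: orthochronous_def)
qed

text \<open>
  On the connected group the time component of the image of a forward null vector is continuous and
  positive at the identity. It cannot vanish, since a null vector without time component is zero and the
  transformations are invertible; so it stays positive.
\<close>

lemma SO0_1n_orthochronous:
  assumes "g \<in> SO0_1n"
  shows "orthochronous g"
proof -
  have sub: "SO0_1n \<subseteq> (SO_1n :: (real^('a option)^('a option)) set)"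
    unfolding SO0_1n_def by (rule connected_component_subset)
  have form: "lorentz_form (k *v v) = lorentz_form v" if "k \<in> SO0_1n" for k :: "real^('a option)^('a option)" and v
    using sub that by (auto simp: SO_1n_def)
  have one: "mat 1 \<in> (SO0_1n :: (real^('a option)^('a option)) set)"
    unfolding SO0_1n_def by (simp add: connected_component_refl_eq SO_1n_def)
  have "0 < (g *v lift x) $ None" if x: "norm x = 1" for x
  proof (rule ccontr)
    assume "\<not> 0 < (g *v lift x) $ None"
    moreover have "connected ((\<lambda>k. k *v lift x) ` SO0_1n)"
      unfolding SO0_1n_def
      by (intro connected_continuous_image connected_connected_component)
        (auto simp: matrix_vector_mult_def intro!: continuous_intros)
    moreover have "0 \<le> (mat 1 *v lift x) $ None"
      by (simp add: lift_eq_spacetime)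
    ultimately obtain v where "v \<in> (\<lambda>k. k *v lift x) ` SO0_1n" "v $ None = 0"
      using connected_ivt_component_cart[of "(\<lambda>k. k *v lift x) ` SO0_1n" "g *v lift x" "mat 1 *v lift x" None 0]
        assms one by (metis image_eqI linorder_not_less)
    then obtain k where k: "k \<in> SO0_1n" "(k *v lift x) $ None = 0" by auto
    have "lorentz_form (k *v lift x) = 0"
      using form[OF k(1)] x by (simp add: lorentz_form_lift)
    with k(2) have "k *v lift x = 0"
      by (intro spacetime_eqI) (simp_all add: lorentz_form_eq, simp add: spatial_def vec_eq_iff)
    moreover have "invertible k"
      using sub k(1) by (auto simp: invertible_det_nz SO_1n_def)
    ultimately have "lift x = 0"
      by (metis matrix_left_invertible_ker invertible_left_inverse)
    then show False
      by (auto simp: lift_eq_spacetime dest: arg_cong[of _ _ "\<lambda>v. v $ None"])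
  qed
  then show ?thesis
    using form[OF assms] by (simp add: orthochronous_def)
qed

lemma matrix_inv_inverse:
  assumes "invertible g"
  shows "g ** matrix_inv g = mat 1" "matrix_inv g ** g = mat 1"
  using someI_ex[OF assms[unfolded invertible_def]] unfolding matrix_inv_def by auto

section \<open>The Jacobian of the action for the surface measure\<close>

lemma borel_measurable_direction: "(\<lambda>y :: real^'n. sgn y) \<in> borel_measurable borel"
  unfolding sgn_div_norm[abs_def] by measurable

text \<open>
  Integrals over the sphere are integrals over the unit ball of functions extended constantly along rays.
\<close>

lemma nn_integral_sphere_measure:
  fixes F :: "real^'n \<Rightarrow> ennreal"
  assumes F: "F \<in> borel_measurable sphere_measure"
  shows "(\<integral>\<^sup>+x. F x \<partial>sphere_measure) =
    of_nat CARD('n) * (\<integral>\<^sup>+y. F (sgn y) * indicator (cball 0 1 - {0}) y \<partial>lborel)"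
proof -
  let ?B = "cball 0 1 - {0 :: real^'n}"
  have F': "F \<in> borel_measurable (restrict_space borel unit_sphere)"
    using F by (simp add: measurable_cong_sets[OF sets_sphere_measure refl])
  have sgn_eq: "(\<lambda>x :: real^'n. x /\<^sub>R norm x) = sgn"
    by (simp add: fun_eq_iff sgn_div_norm)
  have m: "sgn \<in> restrict_space lborel ?B \<rightarrow>\<^sub>M restrict_space borel (unit_sphere :: (real^'n) set)"
    using borel_measurable_direction by (intro measurable_restrict_space3) (auto simp: norm_sgn)
  have "(\<integral>\<^sup>+x. F x \<partial>sphere_measure) = of_nat CARD('n) *
      (\<integral>\<^sup>+x. F x \<partial>distr (restrict_space lborel ?B) (restrict_space borel unit_sphere) sgn)"
    unfolding sphere_measure_def sgn_eq using F' by (intro nn_integral_scale_measure) simp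
  also have "\<dots> = of_nat CARD('n) * (\<integral>\<^sup>+y. F (sgn y) \<partial>restrict_space lborel ?B)"
    using m F' by (simp add: nn_integral_distr)
  also have "\<dots> = of_nat CARD('n) * (\<integral>\<^sup>+y. F (sgn y) * indicator ?B y \<partial>lborel)"
    by (simp add: nn_integral_restrict_space)
  finally show ?thesis .
qed

lemma finite_sphere_measure: "finite_measure (sphere_measure :: (real^'n) measure)"
proof
  have "emeasure (sphere_measure :: (real^'n) measure) unit_sphere
      \<le> of_nat CARD('n) * emeasure lborel (cball 0 1 :: (real^'n) set)"
    by (subst emeasure_sphere_measure) (auto intro!: mult_left_mono emeasure_mono)
  also have "\<dots> < \<infinity>"
    using emeasure_bounded_finite[OF bounded_cball, of "0 :: real^'n" 1]
    by (simp add: ennreal_mult_less_top of_nat_less_top)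
  finally show "emeasure sphere_measure (space (sphere_measure :: (real^'n) measure)) \<noteq> \<infinity>"
    by (simp add: space_sphere_measure)
qed

lemma continuous_on_lorentz_lift: "continuous_on UNIV (\<lambda>x. h *v lift x)"
proof -
  have "bounded_linear (\<lambda>p. h *v spacetime (fst p) (snd p))"
    using bounded_linear_compose[OF matrix_vector_mul_bounded_linear bounded_linear_spacetime] .
  from bounded_linear.continuous_on[OF this, of UNIV "Pair 1"] show ?thesis
    by (simp add: lift_eq_spacetime continuous_on_Pair)
qed

lemma measurable_kappa: "kappa h \<in> borel_measurable borel"
  unfolding kappa_def[abs_def]
  by (intro borel_measurable_inverse borel_measurable_continuous_onI continuous_on_component
      continuous_on_lorentz_lift)

lemma measurable_sphere_act:
  assumes h: "orthochronous h"
  shows "sphere_act h \<in> sphere_measure \<rightarrow>\<^sub>M sphere_measure"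
proof -
  have "(\<lambda>x. kappa h x *\<^sub>R spatial (h *v lift x)) \<in> borel_measurable borel"
    by (intro borel_measurable_scaleR measurable_kappa borel_measurable_continuous_onI
        bounded_linear.continuous_on[OF bounded_linear_spatial] continuous_on_lorentz_lift)
  then have "(\<lambda>x. kappa h x *\<^sub>R spatial (h *v lift x))
      \<in> restrict_space borel unit_sphere \<rightarrow>\<^sub>M restrict_space borel unit_sphere"
    using sphere_act_eq[OF h] by (intro measurable_restrict_space3) auto
  then have "sphere_act h \<in> restrict_space borel unit_sphere \<rightarrow>\<^sub>M restrict_space borel unit_sphere"
    by (rule measurable_cong[THEN iffD1, rotated])
      (simp add: space_restrict_space sphere_act_eq[OF h])
  then show ?thesis
    by (simp add: measurable_cong_sets[OF sets_sphere_measure sets_sphere_measure])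
qed

lemma kappa_measurable_sphere: "kappa h \<in> borel_measurable sphere_measure"
  unfolding measurable_cong_sets[OF sets_sphere_measure refl]
  by (rule measurable_restrict_space1[OF measurable_kappa])

lemma sphere_act_inverse:
  assumes h: "orthochronous h" and h': "orthochronous h'" and inv: "h' ** h = mat 1"
    and x: "norm x = 1"
  shows "sphere_act h' (sphere_act h x) = x"
proof -
  let ?y = "sphere_act h x"
  have y: "norm ?y = 1" using sphere_act_eq(2)[OF h x] .
  have "h' *v lift ?y = kappa h x *\<^sub>R lift x"
    by (simp add: lift_sphere_act[OF h x] matrix_vector_mult_scaleR matrix_vector_mul_assoc inv)
  then have "lift (sphere_act h' ?y) = lift x"
    using kappa_pos[OF h x] by (simp add: lift_sphere_act[OF h' y] kappa_def lift_eq_spacetime[of x] scaleR_spacetime)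
  then show ?thesis by (simp add: lift_eq_spacetime)
qed

text \<open>
  The extended action maps the truncated cone over \<open>A\<close> bijectively to the one over the image of \<open>A\<close>, and its
  Jacobian at \<open>y\<close> is the power of the conformal factor at \<open>y / |y|\<close>.
\<close>

lemma emeasure_sphere_act_image:
  fixes h h' :: "real^('n::finite option)^('n option)"
  assumes h: "orthochronous h" and h': "orthochronous h'"
    and inv: "h' ** h = mat 1" "h ** h' = mat 1"
    and A: "A \<in> sets sphere_measure"
  shows "emeasure sphere_measure (sphere_act h ` A) =
    (\<integral>\<^sup>+x. ennreal (kappa h x ^ (CARD('n) - 1)) * indicator A x \<partial>sphere_measure)"
proof -
  let ?B = "cball 0 1 - {0 :: real^'n}"
  let ?cone = "\<lambda>A. ?B \<inter> sgn -` A"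
  have A_sub: "A \<subseteq> unit_sphere"
    using sets.sets_into_space[OF A] by (simp add: space_sphere_measure)
  have left: "sphere_act h' (sphere_act h x) = x" and right: "sphere_act h (sphere_act h' x) = x"
    if "norm x = 1" for x
    using sphere_act_inverse[OF h h' inv(1) that] sphere_act_inverse[OF h' h inv(2) that] by auto
  have image_eq: "sphere_act h ` A = sphere_act h' -` A \<inter> unit_sphere"
    using A_sub left right sphere_act_eq(2)[OF h] by (force simp: image_iff)
  then have hA: "sphere_act h ` A \<in> sets sphere_measure"
    using measurable_sets[OF measurable_sphere_act[OF h'] A] by (simp add: space_sphere_measure)
  have cone: "?cone C \<in> sets borel" if "C \<in> sets sphere_measure" for C
  proof -
    have "C \<in> sets borel"
      using that by (simp add: sets_sphere_measure sets_restrict_space_iff)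
    then show ?thesis
      using measurable_sets[OF borel_measurable_direction] by (intro sets.Int) auto
  qed
  have sgn_radial: "sgn (radial_act h y) = sphere_act h (sgn y)"
    and norm_radial: "norm (radial_act h y) = norm y" if "y \<noteq> 0" for y
    using that sphere_act_eq(2)[OF h, of "sgn y"]
    by (simp_all add: radial_act_def sgn_scaleR norm_sgn sgn_div_norm[of "sphere_act _ _"])
  have polar: "norm y *\<^sub>R sgn y = y" for y :: "real^'n"
    by (cases "y = 0") (simp_all add: sgn_div_norm)
  have radial_image: "radial_act h ` ?cone A = ?cone (sphere_act h ` A)"
  proof (intro equalityI subsetI)
    fix z assume "z \<in> radial_act h ` ?cone A"
    then obtain y where "y \<in> ?cone A" "z = radial_act h y" by blast
    then have y: "norm y \<le> 1" "y \<noteq> 0" "sgn y \<in> A" and z: "z = radial_act h y" by auto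
    have "norm z = norm y" "sgn z = sphere_act h (sgn y)"
      unfolding z using y(2) by (rule norm_radial, rule sgn_radial)
    moreover from this have "z \<noteq> 0" using y(2) by auto
    ultimately show "z \<in> ?cone (sphere_act h ` A)"
      using y by auto
  next
    fix z assume "z \<in> ?cone (sphere_act h ` A)"
    then obtain a where z: "norm z \<le> 1" "z \<noteq> 0" "sgn z = sphere_act h a" "a \<in> A" by auto
    have a: "norm a = 1" using A_sub z by auto
    have "sgn (norm z *\<^sub>R a) = a"
      using z a by (simp add: sgn_scaleR) (simp add: sgn_div_norm)
    moreover from this have "radial_act h (norm z *\<^sub>R a) = z"
      using z a polar[of z] by (simp add: radial_act_def)
    moreover have "norm z *\<^sub>R a \<noteq> 0"
      using z a by auto
    ultimately show "z \<in> radial_act h ` ?cone A"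
      using z a by (intro image_eqI[where x="norm z *\<^sub>R a"]) auto
  qed
  have inj: "inj_on (radial_act h) (?cone A)"
  proof (rule inj_onI)
    fix y z assume "y \<in> ?cone A" "z \<in> ?cone A" and eq: "radial_act h y = radial_act h z"
    then have y: "y \<noteq> 0" and z: "z \<noteq> 0" by auto
    have "sphere_act h (sgn y) = sphere_act h (sgn z)"
      using sgn_radial[OF y, symmetric] sgn_radial[OF z] unfolding eq by (rule trans)
    moreover have "norm (sgn y) = 1" "norm (sgn z) = 1"
      using y z by (simp_all add: norm_sgn)
    ultimately have "sgn y = sgn z"
      using left by metis
    moreover have "norm y = norm z"
      using norm_radial[OF y, symmetric] norm_radial[OF z] unfolding eq by (rule trans)
    ultimately show "y = z"
      using polar by metis
  qed
  have "\<exists>D. (radial_act h has_derivative D) (at y) \<and> (\<forall>u. (norm (D u))\<^sup>2 =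
      (kappa h (sgn y))\<^sup>2 * (norm u)\<^sup>2 + (1 - (kappa h (sgn y))\<^sup>2) * (sgn y \<bullet> u)\<^sup>2)"
    if "y \<in> ?cone A" for y
    using that radial_act_derivative[OF h, of y] by blast
  then obtain D where D: "\<And>y. y \<in> ?cone A \<Longrightarrow> (radial_act h has_derivative D y) (at y)"
    and stretch: "\<And>y u. y \<in> ?cone A \<Longrightarrow> (norm (D y u))\<^sup>2 =
      (kappa h (sgn y))\<^sup>2 * (norm u)\<^sup>2 + (1 - (kappa h (sgn y))\<^sup>2) * (sgn y \<bullet> u)\<^sup>2"
    by metis
  have main: "emeasure lborel (radial_act h ` ?cone A) =
      (\<integral>\<^sup>+y. ennreal (kappa h (sgn y) ^ (CARD('n) - 1)) * indicator (?cone A) y \<partial>lborel)"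
  proof (rule emeasure_stretch_image[where f' = D and e = sgn])
    show "bounded (radial_act h ` ?cone A)"
      unfolding radial_image by (rule bounded_subset[OF bounded_cball]) auto
    show "(\<lambda>y. kappa h (sgn y)) \<in> borel_measurable borel"
      using measurable_compose[OF borel_measurable_direction measurable_kappa] .
  qed (use cone[OF A] cone[OF hA] radial_image inj D stretch kappa_pos[OF h] in \<open>auto simp: norm_sgn\<close>)
  have "emeasure sphere_measure (sphere_act h ` A) = (\<integral>\<^sup>+x. indicator (sphere_act h ` A) x \<partial>sphere_measure)"
    using hA by simp
  also have "\<dots> = of_nat CARD('n) * (\<integral>\<^sup>+y. indicator (?cone (sphere_act h ` A)) y \<partial>lborel)"
    using hA
    by (subst nn_integral_sphere_measure, simp)
      (intro arg_cong[where f="(*) _"] nn_integral_cong, auto split: split_indicator)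
  also have "\<dots> = of_nat CARD('n) * emeasure lborel (?cone (sphere_act h ` A))"
    using cone[OF hA] by simp
  also have "\<dots> = of_nat CARD('n) *
      (\<integral>\<^sup>+y. ennreal (kappa h (sgn y) ^ (CARD('n) - 1)) * indicator (?cone A) y \<partial>lborel)"
    unfolding main[unfolded radial_image] ..
  also have "\<dots> = (\<integral>\<^sup>+x. ennreal (kappa h x ^ (CARD('n) - 1)) * indicator A x \<partial>sphere_measure)"
    using A kappa_measurable_sphere[of h]
    by (subst nn_integral_sphere_measure, simp)
      (intro arg_cong[where f="(*) _"] nn_integral_cong, auto split: split_indicator)
  finally show ?thesis .
qed

text \<open>
  In this form, as an equation between measures, the Jacobian formula passes to product measures.
\<close>

lemma distr_density_sphere_act:
  fixes h h' :: "real^('n::finite option)^('n option)"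
  assumes h: "orthochronous h" and h': "orthochronous h'"
    and inv: "h' ** h = mat 1" "h ** h' = mat 1"
  shows "distr (density sphere_measure (\<lambda>x. ennreal (kappa h x ^ (CARD('n) - 1))))
    sphere_measure (sphere_act h) = sphere_measure"
proof (rule measure_eqI)
  fix A assume "A \<in> sets (distr (density sphere_measure (\<lambda>x. ennreal (kappa h x ^ (CARD('n) - 1))))
    sphere_measure (sphere_act h))"
  then have A: "A \<in> sets sphere_measure" by simp
  let ?C = "sphere_act h -` A \<inter> unit_sphere"
  have C: "?C \<in> sets sphere_measure"
    using measurable_sets[OF measurable_sphere_act[OF h] A] by (simp add: space_sphere_measure)
  have A_sub: "A \<subseteq> unit_sphere"
    using sets.sets_into_space[OF A] by (simp add: space_sphere_measure)
  have "sphere_act h ` ?C = A"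
  proof safe
    fix a assume "a \<in> A"
    moreover from this have a: "norm a = 1" using A_sub by auto
    moreover have "sphere_act h (sphere_act h' a) = a" "norm (sphere_act h' a) = 1"
      using sphere_act_inverse[OF h' h inv(2) a] sphere_act_eq(2)[OF h' a] .
    ultimately show "a \<in> sphere_act h ` ?C"
      by (intro image_eqI[where x="sphere_act h' a"]) auto
  qed
  then have "emeasure sphere_measure A =
      (\<integral>\<^sup>+x. ennreal (kappa h x ^ (CARD('n) - 1)) * indicator ?C x \<partial>sphere_measure)"
    using emeasure_sphere_act_image[OF h h' inv C] by simp
  then show "emeasure (distr (density sphere_measure (\<lambda>x. ennreal (kappa h x ^ (CARD('n) - 1))))
      sphere_measure (sphere_act h)) A = emeasure sphere_measure A"
    using A C measurable_sphere_act[OF h] kappa_measurable_sphere[of h]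
    by (simp add: emeasure_distr emeasure_density space_sphere_measure)
qed simp

section \<open>The triple integral\<close>

lemma distr_density_pair:
  assumes M: "sigma_finite_measure M" and N: "sigma_finite_measure N"
    and [measurable]: "j \<in> borel_measurable M" "k \<in> borel_measurable N"
    and s [measurable]: "s \<in> M \<rightarrow>\<^sub>M M" and t [measurable]: "t \<in> N \<rightarrow>\<^sub>M N"
    and Ms: "distr (density M j) M s = M" and Nt: "distr (density N k) N t = N"
  shows "distr (density (M \<Otimes>\<^sub>M N) (\<lambda>(x, y). j x * k y)) (M \<Otimes>\<^sub>M N) (\<lambda>(x, y). (s x, t y)) = M \<Otimes>\<^sub>M N"
proof -
  have Nk: "sigma_finite_measure (density N k)"
    by (rule sigma_finite_measure_distr[of _ N t]) (simp_all add: Nt N)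
  have "M \<Otimes>\<^sub>M N = distr (density M j) M s \<Otimes>\<^sub>M distr (density N k) N t"
    by (simp add: Ms Nt)
  also have "\<dots> = distr (density M j \<Otimes>\<^sub>M density N k) (M \<Otimes>\<^sub>M N) (\<lambda>(x, y). (s x, t y))"
    by (rule pair_measure_distr) (simp_all add: Nt N)
  also have "density M j \<Otimes>\<^sub>M density N k = density (M \<Otimes>\<^sub>M N) (\<lambda>(x, y). j x * k y)"
    by (rule pair_measure_density) (simp_all add: N Nk)
  finally show ?thesis by simp
qed

lemma integral_change_of_variables_density:
  fixes F :: "'a \<Rightarrow> 'b::{banach, second_countable_topology}" and r :: "'a \<Rightarrow> real"
  assumes r: "r \<in> borel_measurable M" "\<And>x. x \<in> space M \<Longrightarrow> 0 \<le> r x" and s: "s \<in> M \<rightarrow>\<^sub>M M"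
    and Ms: "distr (density M (\<lambda>x. ennreal (r x))) M s = M" and F: "integrable M F"
  shows "integrable M (\<lambda>x. r x *\<^sub>R F (s x))"
    and "(\<integral>x. r x *\<^sub>R F (s x) \<partial>M) = (\<integral>x. F x \<partial>M)"
proof -
  have F_meas: "F \<in> borel_measurable M" using F by simp
  have Fs: "(\<lambda>x. F (s x)) \<in> borel_measurable M" using measurable_compose[OF s F_meas] .
  have "integrable (distr (density M (\<lambda>x. ennreal (r x))) M s) F"
    using F by (simp add: Ms)
  then show "integrable M (\<lambda>x. r x *\<^sub>R F (s x))"
    using r s F_meas Fs by (subst (asm) integrable_distr_eq) (auto simp: integrable_density)
  have "(\<integral>x. F x \<partial>M) = (\<integral>x. F x \<partial>distr (density M (\<lambda>x. ennreal (r x))) M s)"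
    by (simp add: Ms)
  also have "\<dots> = (\<integral>x. r x *\<^sub>R F (s x) \<partial>M)"
    using r s F_meas Fs by (subst integral_distr) (auto simp: integral_density)
  finally show "(\<integral>x. r x *\<^sub>R F (s x) \<partial>M) = (\<integral>x. F x \<partial>M)" ..
qed

lemma distr_density_sphere_act_triple:
  fixes h h' :: "real^('n::finite option)^('n option)"
  assumes h: "orthochronous h" and h': "orthochronous h'"
    and inv: "h' ** h = mat 1" "h ** h' = mat 1"
  defines "r \<equiv> \<lambda>(x, y, z). (kappa h x * kappa h y * kappa h z) ^ (CARD('n) - 1)"
    and "s \<equiv> \<lambda>(x, y, z). (sphere_act h x, sphere_act h y, sphere_act h z)"
  shows "r \<in> borel_measurable sphere_measure3" "s \<in> sphere_measure3 \<rightarrow>\<^sub>M sphere_measure3"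
    "distr (density sphere_measure3 (\<lambda>x. ennreal (r x))) sphere_measure3 s = sphere_measure3"
proof -
  let ?S = "sphere_measure :: (real^'n) measure"
  define j where "j x = ennreal (kappa h x ^ (CARD('n) - 1))" for x
  note [measurable] = measurable_sphere_act[OF h] kappa_measurable_sphere[of h]
  have [measurable]: "j \<in> borel_measurable ?S"
    unfolding j_def[abs_def] by measurable
  have fin: "sigma_finite_measure ?S"
    using finite_sphere_measure by (rule finite_measure.axioms)
  interpret pair_sigma_finite ?S ?S
    using fin by (simp add: pair_sigma_finite_def)
  show r [measurable]: "r \<in> borel_measurable sphere_measure3"
    unfolding r_def by measurable
  show s [measurable]: "s \<in> sphere_measure3 \<rightarrow>\<^sub>M sphere_measure3"
    unfolding s_def by measurable
  have one: "distr (density ?S j) ?S (sphere_act h) = ?S"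
    using distr_density_sphere_act[OF h h' inv] by (simp add: j_def[abs_def])
  have two: "distr (density (?S \<Otimes>\<^sub>M ?S) (\<lambda>(x, y). j x * j y)) (?S \<Otimes>\<^sub>M ?S)
      (\<lambda>(x, y). (sphere_act h x, sphere_act h y)) = ?S \<Otimes>\<^sub>M ?S"
    by (rule distr_density_pair) (simp_all add: fin one)
  have three: "distr (density sphere_measure3 (\<lambda>(x, p). j x * (case p of (y, z) \<Rightarrow> j y * j z)))
      sphere_measure3 (\<lambda>(x, p). (sphere_act h x, case p of (y, z) \<Rightarrow> (sphere_act h y, sphere_act h z)))
      = sphere_measure3"
    by (rule distr_density_pair) (simp_all add: fin one two sigma_finite_measure_axioms)
  \<comment> \<open>Passing to extended nonnegative reals is multiplicative on nonnegative factors only; on the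
    sphere the conformal factors are positive.\<close>
  have dens: "density sphere_measure3 (\<lambda>x. ennreal (r x))
      = density sphere_measure3 (\<lambda>(x, p). j x * (case p of (y, z) \<Rightarrow> j y * j z))"
    using kappa_pos[OF h]
    by (intro density_cong AE_I2)
      (auto simp: space_pair_measure space_sphere_measure r_def j_def ennreal_mult power_mult_distrib
        mult.assoc less_imp_le)
  have "s = (\<lambda>(x, p). (sphere_act h x, case p of (y, z) \<Rightarrow> (sphere_act h y, sphere_act h z)))"
    by (auto simp: s_def fun_eq_iff)
  with dens three
  show "distr (density sphere_measure3 (\<lambda>x. ennreal (r x))) sphere_measure3 s = sphere_measure3"
    by simp
qed

text \<open>
  Complex powers are multiplicative on nonnegative reals. At coinciding points both sides are \<open>0\<close>.
\<close>

lemma powr_norm_sphere_act_diff: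
  assumes h: "orthochronous h" and x: "norm x = 1" and y: "norm y = 1"
  shows "complex_of_real (norm (sphere_act h x - sphere_act h y)) powr z =
    complex_of_real (kappa h x) powr (z / 2) * complex_of_real (kappa h y) powr (z / 2) *
    complex_of_real (norm (x - y)) powr z"
proof -
  have sqrt: "complex_of_real (sqrt a) powr z = complex_of_real a powr (z / 2)" if "0 < a" for a
    using that by (simp add: powr_def Ln_of_real ln_sqrt)
  have pos: "0 < kappa h x" "0 < kappa h y"
    using kappa_pos[OF h] x y by auto
  have "norm (sphere_act h x - sphere_act h y) = sqrt (kappa h x * kappa h y * (norm (x - y))\<^sup>2)"
    by (simp add: norm_sphere_act_diff[OF h x y, symmetric])
  also have "\<dots> = sqrt (kappa h x) * (sqrt (kappa h y) * norm (x - y))"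
    by (simp add: real_sqrt_mult)
  finally have "complex_of_real (norm (sphere_act h x - sphere_act h y)) powr z =
      complex_of_real (sqrt (kappa h x)) powr z *
      (complex_of_real (sqrt (kappa h y)) powr z * complex_of_real (norm (x - y)) powr z)"
    using pos by (simp add: powr_times_real)
  then show ?thesis
    using pos by (simp add: sqrt)
qed

text \<open>
  The exponents balance: with \<open>2 \<rho> = n - 1\<close>, the factor at the first point on the left-hand side has exponent
  \<open>\<rho> + l1 = 2 \<rho> + (- \<rho> + \<alpha>2) / 2 + (- \<rho> + \<alpha>3) / 2\<close> because \<open>\<alpha>2 + \<alpha>3 = 2 l1\<close>, and likewise at the other two
  points.
\<close>

lemma trilinear_integrand_pi_rep:
  fixes l1 l2 l3 \<alpha>1 \<alpha>2 \<alpha>3 :: complex and f1 f2 f3 :: "real^'n \<Rightarrow> complex"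
    and g :: "real^('n::finite option)^('n option)"
  defines "h \<equiv> matrix_inv g"
  assumes \<alpha>: "\<alpha>1 = - l1 + l2 + l3" "\<alpha>2 = - l2 + l3 + l1" "\<alpha>3 = - l3 + l1 + l2"
    and h: "orthochronous h" and x: "norm x1 = 1" "norm x2 = 1" "norm x3 = 1"
  shows "trilinear_integrand \<alpha>1 \<alpha>2 \<alpha>3 (pi_rep l1 g f1) (pi_rep l2 g f2) (pi_rep l3 g f3) (x1, x2, x3) =
    ((kappa h x1 * kappa h x2 * kappa h x3) ^ (CARD('n) - 1)) *\<^sub>R
    trilinear_integrand \<alpha>1 \<alpha>2 \<alpha>3 f1 f2 f3 (sphere_act h x1, sphere_act h x2, sphere_act h x3)"
proof -
  let ?\<rho> = "complex_of_real (rho TYPE('n))"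
  have rho2: "of_nat (CARD('n) - 1) = 2 * ?\<rho>"
    by (simp add: rho_def of_nat_diff Suc_leI)
  have jac: "complex_of_real (kappa h x) powr (?\<rho> + l) =
      complex_of_real (kappa h x) ^ (CARD('n) - 1) *
      (complex_of_real (kappa h x) powr ((- ?\<rho> + a) / 2) * complex_of_real (kappa h x) powr ((- ?\<rho> + b) / 2))"
    if "norm x = 1" "a + b = 2 * l" for x a b l
  proof -
    have "kappa h x \<noteq> 0" using kappa_pos[OF h that(1)] by simp
    then have "complex_of_real (kappa h x) ^ (CARD('n) - 1) = complex_of_real (kappa h x) powr (2 * ?\<rho>)"
      by (simp add: rho2[symmetric] powr_nat' del: of_nat_diff)
    moreover have l: "l = (a + b) / 2"
      using that(2) by simp
    have "?\<rho> + l = 2 * ?\<rho> + ((- ?\<rho> + a) / 2 + (- ?\<rho> + b) / 2)"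
      unfolding l by (simp add: field_simps)
    ultimately show ?thesis by (simp only: powr_add)
  qed
  have sums: "\<alpha>2 + \<alpha>3 = 2 * l1" "\<alpha>3 + \<alpha>1 = 2 * l2" "\<alpha>1 + \<alpha>2 = 2 * l3"
    by (simp_all add: \<alpha>)
  show ?thesis
    unfolding trilinear_integrand_def kernel_def pi_rep_def h_def[symmetric]
    by (simp add: powr_norm_sphere_act_diff[OF h] x jac[OF x(1) sums(1)] jac[OF x(2) sums(2)]
        jac[OF x(3) sums(3)] scaleR_conv_of_real power_mult_distrib mult_ac)
qed

theorem theorem2p1:
  fixes l1 l2 l3 \<alpha>1 \<alpha>2 \<alpha>3 :: complex
    and f1 f2 f3 :: "real ^ 'n \<Rightarrow> complex"
    and g :: "real ^ ('n::finite option) ^ ('n option)"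
  assumes "CARD('n) \<ge> 3"
    and "\<alpha>1 = - l1 + l2 + l3"
    and "\<alpha>2 = - l2 + l3 + l1"
    and "\<alpha>3 = - l3 + l1 + l2"
    and "smooth_on_sphere f1" and "smooth_on_sphere f2" and "smooth_on_sphere f3"
    and "g \<in> SO0_1n"
    and "trilinear_defined \<alpha>1 \<alpha>2 \<alpha>3 f1 f2 f3"
  shows "trilinear_defined \<alpha>1 \<alpha>2 \<alpha>3 (pi_rep l1 g f1) (pi_rep l2 g f2) (pi_rep l3 g f3) \<and>
         trilinear_form \<alpha>1 \<alpha>2 \<alpha>3 (pi_rep l1 g f1) (pi_rep l2 g f2) (pi_rep l3 g f3) =
           trilinear_form \<alpha>1 \<alpha>2 \<alpha>3 f1 f2 f3"
proof -
  let ?h = "matrix_inv g"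
  let ?F = "trilinear_integrand \<alpha>1 \<alpha>2 \<alpha>3 f1 f2 f3"
  let ?G = "trilinear_integrand \<alpha>1 \<alpha>2 \<alpha>3 (pi_rep l1 g f1) (pi_rep l2 g f2) (pi_rep l3 g f3)"
  define r where "r = (\<lambda>(x, y, z). (kappa ?h x * kappa ?h y * kappa ?h z) ^ (CARD('n) - 1))"
  define s where "s = (\<lambda>(x, y, z). (sphere_act ?h x, sphere_act ?h y, sphere_act ?h z))"
  have "g \<in> SO_1n"
    using assms(8) connected_component_subset unfolding SO0_1n_def by blast
  then have "invertible g"
    by (simp add: SO_1n_def invertible_det_nz)
  note inv = matrix_inv_inverse[OF this]
  have g: "orthochronous g"
    using assms(8) by (rule SO0_1n_orthochronous)
  have h: "orthochronous ?h"
    using g inv(1) by (rule orthochronous_inverse)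
  note change = distr_density_sphere_act_triple[OF h g inv, folded r_def s_def]
  have r_nonneg: "0 \<le> r p" if "p \<in> space sphere_measure3" for p
    using that kappa_pos[OF h]
    by (auto simp: r_def space_pair_measure space_sphere_measure less_imp_le)
  have F: "integrable sphere_measure3 ?F"
    using assms(9) by (simp add: trilinear_defined_def)
  note transformed = integral_change_of_variables_density[OF change(1) r_nonneg change(2,3) F]
  have G: "?G p = r p *\<^sub>R ?F (s p)" if "p \<in> space sphere_measure3" for p
    using that trilinear_integrand_pi_rep[OF assms(2-4) h]
    by (auto simp: r_def s_def space_pair_measure space_sphere_measure)
  have "integrable sphere_measure3 ?G \<longleftrightarrow> integrable sphere_measure3 (\<lambda>p. r p *\<^sub>R ?F (s p))"
    by (rule Bochner_Integration.integrable_cong) (simp_all add: G)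
  moreover have "integral\<^sup>L sphere_measure3 ?G = (\<integral>p. r p *\<^sub>R ?F (s p) \<partial>sphere_measure3)"
    by (rule Bochner_Integration.integral_cong) (simp_all add: G)
  ultimately show ?thesis
    using transformed by (simp add: trilinear_defined_def trilinear_form_def)
qed

end
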